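(* Let $X=W/\langle f\rangle$ be a generic Hopf manifold of dimension $n\ge3$. Then any (possibly singular) codimension-one holomorphic distribution on $X$ is integrable and is induced by a monomial $1$-form.
   Context: Let $W=\mathbb C^n\setminus\{0\}$ and $f(z_1,\dots,z_n)=(\mu_1z_1,\dots,\mu_nz_n)$ with $0<|\mu_i|<1$ for all $i$. The compact complex manifold $X=W/\langle f\rangle$ is called a Hopf manifold. Here $\mathbb N$ includes $0$. $X$ is generic if $0<|\mu_1|\le\dots\le|\mu_n|<1$ and there is no non-trivial relation $\prod_{i\in A}\mu_i^{r_i}=\prod_{j\in B}\mu_j^{r_j}$ with $r_i,r_j\in\mathbb N$, $A\cap B=\emptyset$, $A\cup B=\{1,\dots,n\}$ (non-trivial: not all exponents are zero). For $b\in\mathbb C^*$, $L_b$ is the line bundle on $X$ obtained as the quotient of $W\times\mathbb C$ by $(z,v)\mapsto(f(z),bv)$; every line bundle on $X$ is of this form. A (possibly singular) codimension-one holomorphic distribution on $X$ is given by a nonzero morphism $L_b\to\Omega^1_X$ for some $b\in\mathbb C^*$, i.e. a nonzero section of $\Omega^1_X\otimes L_{b^{-1}}$. Pulling it back to $W$ gives a nonzero holomorphic $1$-form $\omega=\sum g_k\,dz_k$ on $W$ with $g_k(f(z))=\mu_k^{-1}b^{-1}g_k(z)$; one says that the distribution is induced by $\omega$. It is integrable if $\omega\wedge d\omega=0$. A monomial $1$-form is one for which each coefficient $g_k$ is a complex constant times a monomial in $z_1,\dots,z_n$. *)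

theory Defs
  imports "HOL-Analysis.Analysis"
begin

section \<open>Quotients by the group generated by a bijection\<close>

text \<open>
  For a bijection \<open>F\<close> of \<open>S\<close>, two points lie in the same orbit of the group generated by \<open>F\<close>
  iff some forward iterates of them agree; this avoids negative iterates.
\<close>

definition orbit_rel :: "'a set \<Rightarrow> ('a \<Rightarrow> 'a) \<Rightarrow> ('a \<times> 'a) set" where
  "orbit_rel S F = {(p, q). p \<in> S \<and> q \<in> S \<and> (\<exists>m k. (F ^^ m) p = (F ^^ k) q)}"

definition orbit_class :: "'a set \<Rightarrow> ('a \<Rightarrow> 'a) \<Rightarrow> 'a \<Rightarrow> 'a set" where
  "orbit_class S F p = orbit_rel S F `` {p}"

section \<open>Hopf manifolds\<close>

definition W :: "(complex ^ 'n) set" where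
  "W = UNIV - {0}"

definition hopf_map :: "('n \<Rightarrow> complex) \<Rightarrow> complex ^ 'n \<Rightarrow> complex ^ 'n" where
  "hopf_map \<mu> z = (\<chi> i. \<mu> i * z $ i)"

definition hopf_manifold :: "('n \<Rightarrow> complex) \<Rightarrow> (complex ^ 'n) set set" where
  "hopf_manifold \<mu> = W // orbit_rel W (hopf_map \<mu>)"

definition hopf_proj :: "('n \<Rightarrow> complex) \<Rightarrow> complex ^ 'n \<Rightarrow> (complex ^ 'n) set" where
  "hopf_proj \<mu> = orbit_class W (hopf_map \<mu>)"

definition generic_hopf :: "('n::{finite,linorder} \<Rightarrow> complex) \<Rightarrow> bool" where
  "generic_hopf \<mu> \<longleftrightarrow>
     (\<forall>i. 0 < norm (\<mu> i) \<and> norm (\<mu> i) < 1) \<and>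
     (\<forall>i j. i \<le> j \<longrightarrow> norm (\<mu> i) \<le> norm (\<mu> j)) \<and>
     (\<forall>A B. \<forall>r :: 'n \<Rightarrow> nat.
        A \<inter> B = {} \<and> A \<union> B = UNIV \<and> (\<Prod>i\<in>A. \<mu> i ^ r i) = (\<Prod>j\<in>B. \<mu> j ^ r j)
        \<longrightarrow> (\<forall>i. r i = 0))"

section \<open>Holomorphic functions and 1-forms on open subsets of complex n-space\<close>

abbreviation clinear_form :: "(complex ^ 'n \<Rightarrow> complex) \<Rightarrow> bool" where
  "clinear_form \<equiv> Vector_Spaces.linear (*s) (*)"

definition holo_fun_on :: "(complex ^ 'n \<Rightarrow> complex) \<Rightarrow> (complex ^ 'n) set \<Rightarrow> bool" where
  "holo_fun_on h U \<longleftrightarrow> (\<forall>z\<in>U. \<exists>D. clinear_form D \<and> (h has_derivative D) (at z))"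

text \<open>
  A 1-form \<open>\<omega>\<close> sends a point \<open>z\<close> and a tangent vector \<open>u\<close> to \<open>\<omega> z u\<close>.
\<close>

type_synonym 'n one_form = "(complex, 'n) vec \<Rightarrow> (complex, 'n) vec \<Rightarrow> complex"

definition holo_one_form_on ::
    "'n::finite one_form \<Rightarrow> (complex ^ 'n) set \<Rightarrow> bool" where
  "holo_one_form_on \<omega> U \<longleftrightarrow>
     (\<forall>z\<in>U. clinear_form (\<omega> z)) \<and> (\<forall>u. holo_fun_on (\<lambda>z. \<omega> z u) U)"

text \<open>
  The usual formula for \<open>d\<omega>\<close>, evaluated on the constant vector fields \<open>u\<close> and \<open>v\<close>,
  whose bracket vanishes.
\<close>

definition ext_deriv ::
    "'n::finite one_form
      \<Rightarrow> complex ^ 'n \<Rightarrow> complex ^ 'n \<Rightarrow> complex ^ 'n \<Rightarrow> complex" where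
  "ext_deriv \<omega> z u v =
     frechet_derivative (\<lambda>x. \<omega> x v) (at z) u - frechet_derivative (\<lambda>x. \<omega> x u) (at z) v"

definition wedge12 ::
    "('v \<Rightarrow> complex) \<Rightarrow> ('v \<Rightarrow> 'v \<Rightarrow> complex) \<Rightarrow> 'v \<Rightarrow> 'v \<Rightarrow> 'v \<Rightarrow> complex" where
  "wedge12 \<alpha> \<beta> u v w = \<alpha> u * \<beta> v w - \<alpha> v * \<beta> u w + \<alpha> w * \<beta> u v"

definition integrable_form :: "'n::finite one_form \<Rightarrow> bool" where
  "integrable_form \<omega> \<longleftrightarrow> (\<forall>z\<in>W. \<forall>u v w. wedge12 (\<omega> z) (ext_deriv \<omega> z) u v w = 0)"

definition monomial_form :: "'n::finite one_form \<Rightarrow> bool" where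
  "monomial_form \<omega> \<longleftrightarrow>
     (\<exists>(c :: 'n \<Rightarrow> complex) (r :: 'n \<Rightarrow> 'n \<Rightarrow> nat).
        \<forall>z\<in>W. \<forall>u. \<omega> z u = (\<Sum>k\<in>UNIV. (c k * (\<Prod>j\<in>UNIV. z $ j ^ r k j)) * u $ k))"

section \<open>Line bundles, the cotangent bundle and distributions\<close>

text \<open>
  \<open>line_pt \<mu> b z v\<close> is the point of the total space of \<open>L\<^sub>b\<close> represented by \<open>(z, v)\<close>.
\<close>

definition line_pt ::
    "('n \<Rightarrow> complex) \<Rightarrow> complex \<Rightarrow> complex ^ 'n \<Rightarrow> complex \<Rightarrow> ((complex ^ 'n) \<times> complex) set" where
  "line_pt \<mu> b z v = orbit_class (W \<times> UNIV) (\<lambda>(z, v). (hopf_map \<mu> z, b * v)) (z, v)"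

text \<open>
  The holomorphic cotangent bundle of the quotient is the quotient of the cotangent bundle of
  \<open>W\<close> by the map induced by \<open>f\<close>. As \<open>f\<close> is linear, it is its own differential, so a covector
  \<open>\<alpha>\<close> at \<open>z\<close> is carried to the covector \<open>\<alpha> \<circ> f\<inverse>\<close> at \<open>f z\<close>.
\<close>

definition cotangent_pt ::
    "('n \<Rightarrow> complex) \<Rightarrow> complex ^ 'n \<Rightarrow> (complex ^ 'n \<Rightarrow> complex)
      \<Rightarrow> ((complex ^ 'n) \<times> (complex ^ 'n \<Rightarrow> complex)) set" where
  "cotangent_pt \<mu> z \<alpha> =
     orbit_class (W \<times> {\<alpha>. clinear_form \<alpha>})
       (\<lambda>(z, \<alpha>). (hopf_map \<mu> z, \<alpha> \<circ> hopf_map (\<lambda>i. inverse (\<mu> i)))) (z, \<alpha>)"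

type_synonym 'n bundle_map =
  "((complex, 'n) vec \<times> complex) set \<Rightarrow> ((complex, 'n) vec \<times> ((complex, 'n) vec \<Rightarrow> complex)) set"

text \<open>
  \<open>\<phi>\<close> is a holomorphic morphism of vector bundles from \<open>L\<^sub>b\<close> to the cotangent bundle. The charts
  of the Hopf manifold are the inverses of \<open>hopf_proj \<mu>\<close> on open sets \<open>U\<close> where it is injective;
  over such a set, \<open>(z, v)\<close> and \<open>(z, \<alpha>)\<close> are trivialising coordinates of the two bundles, and
  the morphism, being linear on fibres and covering the identity, has the form
  \<open>(z, v) \<mapsto> (z, v \<sqdot> g z)\<close> with \<open>g\<close> holomorphic. Values of \<open>\<phi>\<close> outside the total space of
  \<open>L\<^sub>b\<close> are irrelevant.
\<close>

definition bundle_morphism ::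
    "('n::finite \<Rightarrow> complex) \<Rightarrow> complex \<Rightarrow> 'n bundle_map \<Rightarrow> bool" where
  "bundle_morphism \<mu> b \<phi> \<longleftrightarrow>
     (\<forall>x\<in>hopf_manifold \<mu>. \<exists>U g.
        open U \<and> U \<subseteq> W \<and> inj_on (hopf_proj \<mu>) U \<and> x \<in> hopf_proj \<mu> ` U \<and>
        holo_one_form_on g U \<and>
        (\<forall>z\<in>U. \<forall>v. \<phi> (line_pt \<mu> b z v) = cotangent_pt \<mu> z (\<lambda>u. v * g z u)))"

definition distribution ::
    "('n::finite \<Rightarrow> complex) \<Rightarrow> complex \<Rightarrow> 'n bundle_map \<Rightarrow> bool" where
  "distribution \<mu> b \<phi> \<longleftrightarrow>
     b \<noteq> 0 \<and> bundle_morphism \<mu> b \<phi> \<and>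
     (\<exists>z\<in>W. \<exists>v. \<phi> (line_pt \<mu> b z v) \<noteq> cotangent_pt \<mu> z (\<lambda>u. 0))"

text \<open>
  The distribution \<open>\<phi>\<close> is induced by \<open>\<omega>\<close> if \<open>\<omega>\<close> is the pullback of \<open>\<phi>\<close> to \<open>W\<close>, where \<open>L\<^sub>b\<close>
  pulls back to the trivial bundle. Since the group generated by \<open>f\<close> acts freely on \<open>W\<close>,
  such an \<open>\<omega>\<close> is uniquely determined on \<open>W\<close>.
\<close>

definition induced_by ::
    "('n::finite \<Rightarrow> complex) \<Rightarrow> complex \<Rightarrow> 'n bundle_map \<Rightarrow> 'n one_form \<Rightarrow> bool" where
  "induced_by \<mu> b \<phi> \<omega> \<longleftrightarrow>
     holo_one_form_on \<omega> W \<and>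
     (\<forall>z\<in>W. \<forall>v. \<phi> (line_pt \<mu> b z v) = cotangent_pt \<mu> z (\<lambda>u. v * \<omega> z u))"

definition integrable_distribution ::
    "('n::finite \<Rightarrow> complex) \<Rightarrow> complex \<Rightarrow> 'n bundle_map \<Rightarrow> bool" where
  "integrable_distribution \<mu> b \<phi> \<longleftrightarrow> (\<exists>\<omega>. induced_by \<mu> b \<phi> \<omega> \<and> integrable_form \<omega>)"

end

theory Submission
  imports Defs "HOL-Complex_Analysis.Cauchy_Integral_Formula"
begin

text \<open>
  A morphism \<open>L\<^sub>b \<rightarrow> \<Omega>\<^sup>1\<close> pulls back to a holomorphic 1-form \<open>\<omega> = \<Sum> g\<^sub>k dz\<^sub>k\<close> on \<open>W\<close> with
  \<open>b f\<^sup>*\<omega> = \<omega>\<close> (\<open>bundle_morphism_induced\<close>, \<open>induced_by_equivariant\<close>), so each coefficient is an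
  eigenfunction of the contraction: \<open>g\<^sub>k \<circ> f = (b \<mu>\<^sub>k)\<inverse> g\<^sub>k\<close>. Everything rests on the fact that such
  an eigenfunction \<open>g\<close> is a constant times a monomial (\<open>hopf_eigenfunction_is_monomial\<close>).
  
  The classical argument extends \<open>g\<close> over the origin by Hartogs' theorem and compares power series
  coefficients. The argument given here looks at infinity instead of the origin. Iterating
  \<open>g \<circ> f = \<kappa> g\<close> transports the bound of \<open>g\<close> on a compact shell to all of \<open>\<bar>z\<bar> \<ge> 1\<close>, which shows
  that \<open>g\<close> grows at most like a power \<open>\<bar>z\<bar>^M\<close>. Fix all coordinates but one, at least one of them
  being nonzero: the resulting line avoids the origin, so \<open>g\<close> restricted to it is entire of
  polynomial growth, hence a polynomial of degree at most \<open>M\<close> by Liouville. A function that is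
  polynomial of bounded degree in each variable separately is a polynomial, by Lagrange
  interpolation in one variable after the other. For a polynomial the equation
  \<open>g \<circ> f = \<kappa> g\<close> leaves only the monomials \<open>z^\<alpha>\<close> with \<open>\<mu>^\<alpha> = \<kappa>\<close>; multiplicative independence of
  the \<open>\<mu>\<^sub>i\<close> (\<open>generic_hopf_independent\<close>) allows at most one.
  
  So \<open>g\<^sub>k = c\<^sub>k z^\<alpha>\<^sub>k\<close>, and \<open>c\<^sub>k \<noteq> 0\<close> implies \<open>\<mu>^(\<alpha>\<^sub>k + e\<^sub>k) = b\<inverse>\<close>. By independence once more,
  \<open>\<alpha>\<^sub>k + e\<^sub>k\<close> is the same exponent \<open>m\<close> for all these \<open>k\<close>. Hence \<open>\<omega> = z^m \<Sum> c\<^sub>k dz\<^sub>k / z\<^sub>k\<close> where no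
  coordinate vanishes: a function times a closed form, which is integrable
  (\<open>integrable_monomial_one_form\<close>).
\<close>

section \<open>Polynomial functions and the open torus\<close>

definition mono_fun :: "('n::finite \<Rightarrow> nat) \<Rightarrow> complex ^ 'n \<Rightarrow> complex" where
  "mono_fun \<alpha> z = (\<Prod>j\<in>UNIV. z $ j ^ \<alpha> j)"

definition poly_fun :: "(complex ^ 'n::finite \<Rightarrow> complex) \<Rightarrow> bool" where
  "poly_fun h \<longleftrightarrow> (\<exists>I c. finite I \<and> (\<forall>z. h z = (\<Sum>\<alpha>\<in>I. c \<alpha> * mono_fun \<alpha> z)))"

text \<open>
  The torus is dense and is preserved by changing one coordinate to a nonzero value. It is therefore
  the place where variables can be treated one at a time and where dividing by coordinates is possible.
\<close>

definition torus :: "(complex ^ 'n::finite) set" where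
  "torus = {z. \<forall>i. z $ i \<noteq> 0}"

definition set_coord :: "complex ^ 'n \<Rightarrow> 'n \<Rightarrow> complex \<Rightarrow> complex ^ 'n" where
  "set_coord z i t = (\<chi> j. if j = i then t else z $ j)"

lemma set_coord_nth: "set_coord z i t $ j = (if j = i then t else z $ j)"
  by (simp add: set_coord_def)

lemma set_coord_self: "set_coord z i (z $ i) = z"
  by (simp add: set_coord_def vec_eq_iff)

lemma set_coord_commute:
  "i \<noteq> j \<Longrightarrow> set_coord (set_coord z i s) j t = set_coord (set_coord z j t) i s"
  by (auto simp: set_coord_def vec_eq_iff)

lemma set_coord_torus: "z \<in> torus \<Longrightarrow> t \<noteq> 0 \<Longrightarrow> set_coord z i t \<in> torus"
  by (simp add: torus_def set_coord_nth)

lemma poly_fun_term: "poly_fun (\<lambda>z. c * mono_fun \<alpha> z)"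
  unfolding poly_fun_def by (intro exI[of _ "{\<alpha>}"] exI[of _ "\<lambda>_. c"]) simp

lemma poly_fun_add:
  assumes "poly_fun g" "poly_fun h"
  shows "poly_fun (\<lambda>z. g z + h z)"
proof -
  from assms obtain I c J d where I: "finite I" "\<And>z. g z = (\<Sum>\<alpha>\<in>I. c \<alpha> * mono_fun \<alpha> z)"
    and J: "finite J" "\<And>z. h z = (\<Sum>\<alpha>\<in>J. d \<alpha> * mono_fun \<alpha> z)"
    unfolding poly_fun_def by blast
  let ?e = "\<lambda>\<alpha>. (if \<alpha> \<in> I then c \<alpha> else 0) + (if \<alpha> \<in> J then d \<alpha> else 0)"
  have "g z + h z = (\<Sum>\<alpha>\<in>I \<union> J. ?e \<alpha> * mono_fun \<alpha> z)" for z
  proof -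
    have "g z = (\<Sum>\<alpha>\<in>I \<union> J. (if \<alpha> \<in> I then c \<alpha> else 0) * mono_fun \<alpha> z)"
      unfolding I(2) using I(1) J(1) by (intro sum.mono_neutral_cong_left) auto
    moreover have "h z = (\<Sum>\<alpha>\<in>I \<union> J. (if \<alpha> \<in> J then d \<alpha> else 0) * mono_fun \<alpha> z)"
      unfolding J(2) using I(1) J(1) by (intro sum.mono_neutral_cong_left) auto
    ultimately show ?thesis
      by (simp only: distrib_right sum.distrib)
  qed
  with I(1) J(1) show ?thesis
    unfolding poly_fun_def by (intro exI[of _ "I \<union> J"] exI[of _ ?e]) simp
qed

lemma poly_fun_sum:
  assumes "\<And>a. a \<in> A \<Longrightarrow> poly_fun (h a)"
  shows "poly_fun (\<lambda>z. \<Sum>a\<in>A. h a z)"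
proof -
  have zero: "poly_fun (\<lambda>z::complex ^ 'b. 0)"
    using poly_fun_term[of 0] by simp
  show ?thesis
    using assms by (induction A rule: infinite_finite_induct) (simp_all add: zero poly_fun_add)
qed

lemma mono_fun_times_coord:
  "mono_fun \<alpha> z * z $ i ^ d = mono_fun (\<alpha>(i := \<alpha> i + d)) z"
proof -
  have "mono_fun (\<alpha>(i := \<alpha> i + d)) z = z $ i ^ (\<alpha> i + d) * (\<Prod>j\<in>UNIV - {i}. z $ j ^ \<alpha> j)"
    unfolding mono_fun_def by (subst prod.remove[of _ i]) (auto intro!: prod.cong)
  moreover have "mono_fun \<alpha> z = z $ i ^ \<alpha> i * (\<Prod>j\<in>UNIV - {i}. z $ j ^ \<alpha> j)"
    unfolding mono_fun_def by (subst prod.remove[of _ i]) auto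
  ultimately show ?thesis by (simp add: power_add)
qed

lemma poly_fun_times_poly_coord:
  assumes "poly_fun h"
  shows "poly_fun (\<lambda>z. h z * poly p (z $ i))"
proof -
  from assms obtain I c where I: "\<And>z. h z = (\<Sum>\<alpha>\<in>I. c \<alpha> * mono_fun \<alpha> z)"
    unfolding poly_fun_def by blast
  have "h z * poly p (z $ i) =
      (\<Sum>\<alpha>\<in>I. \<Sum>d\<le>degree p. (c \<alpha> * coeff p d) * mono_fun (\<alpha>(i := \<alpha> i + d)) z)" for z
    unfolding I poly_altdef mono_fun_times_coord[symmetric]
    by (simp add: sum_product mult_ac)
  then show ?thesis
    by (simp only: poly_fun_sum poly_fun_term)
qed

text \<open>
  The basis polynomials \<open>L a\<close> depend on the nodes only, so one formula serves all polynomials of small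
  degree at once, in particular a family whose coefficients depend on further variables.
\<close>

lemma lagrange_interpolation:
  fixes A :: "'a::field set"
  assumes "finite A"
  obtains L :: "'a \<Rightarrow> 'a poly"
  where "\<And>p x. degree p < card A \<Longrightarrow> poly p x = (\<Sum>a\<in>A. poly p a * poly (L a) x)"
proof
  let ?L = "\<lambda>a. \<Prod>c\<in>A - {a}. smult (1 / (a - c)) [:- c, 1:]"
  fix p :: "'a poly" and x
  assume p: "degree p < card A"
  have val: "poly (?L a) b = (if a = b then 1 else 0)" if "a \<in> A" "b \<in> A" for a b
  proof (cases "a = b")
    case True
    have "poly (smult (1 / (a - c)) [:- c, 1:]) a = 1" if "c \<in> A - {a}" for c
    proof -
      have "a / (a - c) - c / (a - c) = 1"
        using that unfolding diff_divide_distrib[symmetric] by auto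
      then show ?thesis
        by simp
    qed
    then have "(\<Prod>c\<in>A - {a}. poly (smult (1 / (a - c)) [:- c, 1:]) a) = 1"
      by (rule prod.neutral[rule_format])
    then show ?thesis
      unfolding poly_prod True[symmetric] by simp
  next
    case False
    then show ?thesis
      using that assms by (auto simp: poly_prod intro!: prod_zero bexI[of _ b])
  qed
  let ?q = "\<Sum>a\<in>A. smult (poly p a) (?L a)"
  have "degree (?L a) \<le> card A - 1" if "a \<in> A" for a
  proof -
    have "degree (?L a) \<le> (\<Sum>c\<in>A - {a}. degree (smult (1 / (a - c)) [:- c, 1:]))"
      using degree_prod_sum_le[of "A - {a}" "\<lambda>c. smult (1 / (a - c)) [:- c, 1:]"] assms
      by (simp only: finite_Diff o_def)
    also have "\<dots> \<le> (\<Sum>c\<in>A - {a}. 1)"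
      by (intro sum_mono) simp
    finally show ?thesis
      using that assms by simp
  qed
  then have "degree ?q \<le> card A - 1"
    using assms by (intro degree_sum_le) (auto intro: order.trans[OF degree_smult_le])
  then have q: "degree ?q < card A"
    using p by linarith
  have "p = ?q"
  proof (rule poly_eqI_degree[where A = A])
    fix b assume b: "b \<in> A"
    have "poly ?q b = (\<Sum>a\<in>A. poly p a * (if a = b then 1 else 0))"
      unfolding poly_sum poly_smult using b val by (intro sum.cong) simp_all
    then show "poly p b = poly ?q b"
      using b assms by (simp add: if_distrib cong: if_cong)
  qed (use p q in auto)
  then have "poly p x = poly ?q x"
    by simp
  then show "poly p x = (\<Sum>a\<in>A. poly p a * poly (?L a) x)"
    by (simp add: poly_sum)
qed

text \<open>
  Interpolating in the variable \<open>i\<close> writes \<open>G\<close> as a sum of products \<open>G(\<dots>, a, \<dots>) L\<^sub>a(z\<^sub>i)\<close>, in which the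
  first factor has one variable fewer; induction on the set \<open>S\<close> of variables on which \<open>G\<close> depends
  does the rest. The uniform bound \<open>M\<close> lets the same finite set of nodes work everywhere.
\<close>

lemma poly_fun_if_separately_polynomial:
  fixes G :: "complex ^ 'n::finite \<Rightarrow> complex"
  assumes "finite S"
    and "\<And>i z. i \<in> S \<Longrightarrow> z \<in> torus \<Longrightarrow>
           \<exists>p. degree p \<le> M \<and> (\<forall>t. t \<noteq> 0 \<longrightarrow> G (set_coord z i t) = poly p t)"
    and "\<And>z w. z \<in> torus \<Longrightarrow> w \<in> torus \<Longrightarrow> (\<forall>i\<in>S. z $ i = w $ i) \<Longrightarrow> G z = G w"
  shows "\<exists>h. poly_fun h \<and> (\<forall>z\<in>torus. G z = h z)"
  using assms
proof (induction S arbitrary: G rule: finite_induct)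
  case empty
  have "G z = G 1 * mono_fun (\<lambda>_. 0) z" if "z \<in> torus" for z
    using empty.prems(2)[OF that, of 1] by (simp add: torus_def mono_fun_def)
  then show ?case
    using poly_fun_term by blast
next
  case (insert i S)
  \<comment> \<open>The nodes are nonzero so that substituting them does not leave the torus.\<close>
  define A where "A = (of_nat :: nat \<Rightarrow> complex) ` {1..M + 1}"
  have A: "finite A" "card A = M + 1" "0 \<notin> A"
    unfolding A_def by (auto simp: card_image inj_on_def simp del: of_nat_Suc)
  obtain L where L: "\<And>p x. degree p < card A \<Longrightarrow> poly p x = (\<Sum>a\<in>A. poly p a * poly (L a) x)"
    using lagrange_interpolation[OF A(1)] by blast
  have "\<exists>h. poly_fun h \<and> (\<forall>z\<in>torus. G (set_coord z i a) = h z)" if a: "a \<in> A" for a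
  proof (rule insert.IH)
    have a0: "a \<noteq> 0"
      using a A(3) by auto
    fix j and z :: "complex ^ 'n"
    assume j: "j \<in> S" and z: "z \<in> torus"
    obtain p where "degree p \<le> M" and p: "\<forall>t. t \<noteq> 0 \<longrightarrow> G (set_coord (set_coord z i a) j t) = poly p t"
      using insert.prems(1)[of j "set_coord z i a"] j set_coord_torus[OF z a0] by auto
    moreover have "j \<noteq> i"
      using j insert.hyps by auto
    ultimately show "\<exists>p. degree p \<le> M \<and> (\<forall>t. t \<noteq> 0 \<longrightarrow> G (set_coord (set_coord z j t) i a) = poly p t)"
      using set_coord_commute[of i j] by metis
  next
    have a0: "a \<noteq> 0"
      using a A(3) by auto
    fix z w :: "complex ^ 'n"
    assume "z \<in> torus" "w \<in> torus" "\<forall>i\<in>S. z $ i = w $ i"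
    then show "G (set_coord z i a) = G (set_coord w i a)"
      by (intro insert.prems(2)) (auto simp: set_coord_torus[OF _ a0] set_coord_nth)
  qed
  then obtain H where H: "\<And>a. a \<in> A \<Longrightarrow> poly_fun (H a)"
    "\<And>a z. a \<in> A \<Longrightarrow> z \<in> torus \<Longrightarrow> G (set_coord z i a) = H a z"
    by metis
  have "G z = (\<Sum>a\<in>A. H a z * poly (L a) (z $ i))" if z: "z \<in> torus" for z
  proof -
    obtain p where p: "degree p \<le> M" "\<And>t. t \<noteq> 0 \<Longrightarrow> G (set_coord z i t) = poly p t"
      using insert.prems(1)[OF _ z, of i] by auto
    have "G z = poly p (z $ i)"
      using p(2)[of "z $ i"] z by (simp add: set_coord_self torus_def)
    also have "\<dots> = (\<Sum>a\<in>A. poly p a * poly (L a) (z $ i))"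
      using L p(1) A(2) by simp
    also have "\<dots> = (\<Sum>a\<in>A. H a z * poly (L a) (z $ i))"
    proof (intro sum.cong refl)
      fix a assume a: "a \<in> A"
      then have "a \<noteq> 0"
        using A(3) by auto
      then show "poly p a * poly (L a) (z $ i) = H a z * poly (L a) (z $ i)"
        using p(2)[of a] H(2)[OF a z] by simp
    qed
    finally show ?thesis .
  qed
  moreover have "poly_fun (\<lambda>z. \<Sum>a\<in>A. H a z * poly (L a) (z $ i))"
    using H(1) by (intro poly_fun_sum poly_fun_times_poly_coord)
  ultimately show ?case
    by blast
qed

text \<open>
  The torus is dense: moving from \<open>z\<close> along the diagonal direction \<open>(1, \<dots>, 1)\<close> leaves all coordinate
  hyperplanes at once.
\<close>

lemma zero_if_zero_on_torus:
  fixes F :: "complex ^ 'n::finite \<Rightarrow> complex"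
  assumes "isCont F z" and zero: "\<And>x. x \<in> torus \<Longrightarrow> F x = 0"
  shows "F z = 0"
proof -
  let ?\<gamma> = "\<lambda>t. z + (\<chi> i. t)"
  have "((\<lambda>t. z + (\<chi> i. t)) \<longlongrightarrow> z + (\<chi> i. 0)) (at 0)"
    by (rule tendsto_add[OF tendsto_const tendsto_vec_lambda[OF tendsto_ident_at]])
  also have "z + (\<chi> i. 0) = z"
    by (simp add: vec_eq_iff)
  finally have "((\<lambda>t. F (?\<gamma> t)) \<longlongrightarrow> F z) (at 0)"
    by (rule isCont_tendsto_compose[OF assms(1)])
  moreover have "\<forall>\<^sub>F t in at 0. F (?\<gamma> t) = 0"
  proof -
    have "\<forall>\<^sub>F t in at 0. \<forall>i. t \<noteq> - z $ i"
      by (intro eventually_all_finite eventually_neq_at_within)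
    then show ?thesis
    proof eventually_elim
      case (elim t)
      then have "?\<gamma> t \<in> torus"
        by (simp add: torus_def add_eq_0_iff)
      then show ?case by (rule zero)
    qed
  qed
  ultimately show ?thesis
    using tendsto_unique[OF at_neq_bot _ tendsto_eventually] by blast
qed


section \<open>Eigenfunctions of a diagonal contraction\<close>

lemma hopf_map_nth: "hopf_map \<mu> z $ i = \<mu> i * z $ i"
  by (simp add: hopf_map_def)

lemma hopf_map_iter: "(hopf_map \<mu> ^^ k) z = hopf_map (\<lambda>i. \<mu> i ^ k) z"
  by (induction k) (simp_all add: hopf_map_def vec_eq_iff)

lemma hopf_map_in_W:
  assumes "\<And>i. \<mu> i \<noteq> 0"
  shows "hopf_map \<mu> z \<in> W \<longleftrightarrow> z \<in> W"
  using assms by (simp add: W_def vec_eq_iff hopf_map_nth)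

lemma norm_hopf_map_le:
  assumes "\<And>i. norm (\<mu> i) \<le> r" "0 \<le> r"
  shows "norm (hopf_map \<mu> z) \<le> r * norm z"
proof -
  have "norm (hopf_map \<mu> z) \<le> L2_set (\<lambda>i. r * norm (z $ i)) UNIV"
    unfolding norm_vec_def
    by (intro L2_set_mono) (auto simp: hopf_map_nth norm_mult intro: mult_right_mono assms)
  then show ?thesis
    using assms(2) by (simp add: norm_vec_def L2_set_right_distrib)
qed

lemma norm_hopf_map_ge:
  assumes "\<And>i. r \<le> norm (\<mu> i)" "0 \<le> r"
  shows "r * norm z \<le> norm (hopf_map \<mu> z)"
proof -
  have "L2_set (\<lambda>i. r * norm (z $ i)) UNIV \<le> norm (hopf_map \<mu> z)"
    unfolding norm_vec_def
    by (intro L2_set_mono) (auto simp: hopf_map_nth norm_mult assms intro: mult_right_mono assms)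
  then show ?thesis
    using assms(2) by (simp add: norm_vec_def L2_set_right_distrib)
qed

lemma mono_fun_hopf_map:
  "mono_fun \<alpha> (hopf_map \<mu> z) = (\<Prod>j\<in>UNIV. \<mu> j ^ \<alpha> j) * mono_fun \<alpha> z"
  by (simp add: mono_fun_def hopf_map_nth power_mult_distrib prod.distrib)

lemma has_derivative_mono_fun:
  "(mono_fun \<alpha> has_derivative
     (\<lambda>u. \<Sum>j\<in>UNIV. of_nat (\<alpha> j) * mono_fun (\<alpha>(j := \<alpha> j - 1)) z * u $ j)) (at z)"
proof -
  have nth: "((\<lambda>z. z $ j) has_derivative (\<lambda>u. u $ j)) (at z)" for j
    by (rule bounded_linear_imp_has_derivative[OF bounded_linear_vec_nth])
  have "((\<lambda>z. \<Prod>j\<in>UNIV. z $ j ^ \<alpha> j) has_derivative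
     (\<lambda>u. \<Sum>j\<in>UNIV. (of_nat (\<alpha> j) * u $ j * z $ j ^ (\<alpha> j - 1)) * (\<Prod>i\<in>UNIV - {j}. z $ i ^ \<alpha> i)))
     (at z)"
    by (rule has_derivative_prod) (rule has_derivative_power[OF nth])
  moreover have "(of_nat (\<alpha> j) * u $ j * z $ j ^ (\<alpha> j - 1)) * (\<Prod>i\<in>UNIV - {j}. z $ i ^ \<alpha> i)
      = of_nat (\<alpha> j) * mono_fun (\<alpha>(j := \<alpha> j - 1)) z * u $ j" for j u
  proof -
    have "mono_fun (\<alpha>(j := \<alpha> j - 1)) z = z $ j ^ (\<alpha> j - 1) * (\<Prod>i\<in>UNIV - {j}. z $ i ^ \<alpha> i)"
      unfolding mono_fun_def by (subst prod.remove[of UNIV j]) (auto intro!: prod.cong)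
    then show ?thesis
      by (simp add: mult_ac)
  qed
  ultimately show ?thesis
    by (simp only: mono_fun_def[abs_def])
qed

lemma isCont_mono_fun: "isCont (mono_fun \<alpha>) z"
  using has_derivative_mono_fun has_derivative_continuous by blast

lemma clinear_form_iff:
  "clinear_form D \<longleftrightarrow> (\<forall>x y. D (x + y) = D x + D y) \<and> (\<forall>c x. D (c *s x) = c * D x)"
  using vec.vector_space_axioms vector_space_over_itself.vector_space_axioms
  unfolding Vector_Spaces.linear_iff by blast

lemma holo_fun_on_isCont:
  assumes "holo_fun_on g U" "z \<in> U"
  shows "isCont g z"
  using assms has_derivative_continuous unfolding holo_fun_on_def by blast

lemma holomorphic_set_coord:
  fixes g :: "complex ^ 'n::finite \<Rightarrow> complex"
  assumes g: "holo_fun_on g W" and "\<And>t. set_coord z i t \<in> W"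
  shows "(\<lambda>t. g (set_coord z i t)) holomorphic_on UNIV"
proof -
  have "(\<lambda>t. g (set_coord z i t)) field_differentiable at t" for t
  proof -
    obtain D where D: "clinear_form D" "(g has_derivative D) (at (set_coord z i t))"
      using assms unfolding holo_fun_on_def by blast
    have eq: "set_coord z i = (\<lambda>t. set_coord z i 0 + t *s axis i 1)"
      by (auto simp: fun_eq_iff vec_eq_iff set_coord_nth axis_def)
    have "((\<lambda>t. t *s axis i 1 :: complex ^ 'n) has_derivative (\<lambda>t. t *s axis i 1)) (at t)"
    proof (rule bounded_linear_imp_has_derivative)
      show "bounded_linear (\<lambda>t. t *s axis i 1 :: complex ^ 'n)"
        by (intro linear_conv_bounded_linear[THEN iffD1] linearI)
          (simp_all add: vec_eq_iff algebra_simps)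
    qed
    then have "((\<lambda>t. set_coord z i 0 + t *s axis i 1) has_derivative (\<lambda>t. 0 + t *s axis i 1)) (at t)"
      by (rule has_derivative_add[OF has_derivative_const])
    then have "(set_coord z i has_derivative (\<lambda>t. t *s axis i 1)) (at t)"
      unfolding eq[symmetric] by simp
    then have "((\<lambda>t. g (set_coord z i t)) has_derivative (\<lambda>t. D (t *s axis i 1))) (at t)"
      using D(2) by (rule has_derivative_compose)
    moreover have "(\<lambda>t. D (t *s axis i 1)) = (*) (D (axis i 1))"
      using D(1) by (auto simp: fun_eq_iff clinear_form_iff)
    ultimately have "((\<lambda>t. g (set_coord z i t)) has_derivative (*) (D (axis i 1))) (at t)"
      by simp
    then show ?thesis
      unfolding field_differentiable_def has_field_derivative_def by blast
  qed
  then show ?thesis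
    by (simp add: holomorphic_on_def field_differentiable_at_within)
qed

text \<open>
  With \<open>\<rho> \<le> \<bar>\<mu>\<^sub>i\<bar> \<le> r < 1\<close>, every point of norm at least 1 is moved by an iterate of \<open>f\<close> into the shell
  \<open>\<rho> \<le> \<bar>z\<bar> \<le> 1\<close>, where \<open>g\<close> is bounded by compactness. Undoing one step multiplies \<open>g\<close> by \<open>\<kappa>\<inverse>\<close> while
  the norm grows at least by the factor \<open>r\<inverse>\<close>; any exponent \<open>M\<close> with \<open>r ^ M < \<bar>\<kappa>\<bar>\<close> is large enough.
\<close>

lemma hopf_eigenfunction_growth:
  fixes g :: "complex ^ 'n::finite \<Rightarrow> complex"
  assumes \<mu>: "\<And>i. 0 < norm (\<mu> i)" "\<And>i. norm (\<mu> i) < 1"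
    and "\<kappa> \<noteq> 0" and g: "holo_fun_on g W"
    and eig: "\<And>z. z \<in> W \<Longrightarrow> g (hopf_map \<mu> z) = \<kappa> * g z"
  obtains C M where "0 \<le> C" "\<And>z. 1 \<le> norm z \<Longrightarrow> norm (g z) \<le> C * norm z ^ M"
proof -
  define \<rho> where "\<rho> = Min (range (\<lambda>i. norm (\<mu> i)))"
  define r where "r = Max (range (\<lambda>i. norm (\<mu> i)))"
  have \<rho>: "0 < \<rho>" "\<And>i. \<rho> \<le> norm (\<mu> i)"
    unfolding \<rho>_def using \<mu>(1) by auto
  have r: "r < 1" "\<And>i. norm (\<mu> i) \<le> r"
    unfolding r_def using \<mu>(2) by auto
  have r0: "0 < r"
    using \<mu>(1) r(2) by (meson less_le_trans)
  have \<rho>1: "\<rho> \<le> 1"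
    using \<rho>(2) \<mu>(2) by (meson less_imp_le order.trans)
  obtain M where M: "r ^ M < norm \<kappa>"
    using real_arch_pow_inv[of "norm \<kappa>" r] r(1) \<open>\<kappa> \<noteq> 0\<close> by auto
  define K where "K = {z :: complex ^ 'n. \<rho> \<le> norm z \<and> norm z \<le> 1}"
  have "K = cball 0 1 - ball 0 \<rho>"
    by (auto simp: K_def)
  then have "compact K"
    by (simp add: compact_diff)
  have KW: "z \<in> W" if "\<rho> \<le> norm z" for z :: "complex ^ 'n"
    using that \<rho>(1) by (auto simp: W_def)
  have "continuous_on K g"
    by (rule continuous_at_imp_continuous_on)
      (use holo_fun_on_isCont[OF g] KW in \<open>auto simp: K_def\<close>)
  then have "bounded (g ` K)"
    using \<open>compact K\<close> compact_continuous_image compact_imp_bounded by blast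
  then obtain B where B: "0 < B" "\<And>z. z \<in> K \<Longrightarrow> norm (g z) \<le> B"
    unfolding bounded_pos by auto
  \<comment> \<open>The division by \<open>\<rho> ^ M\<close> makes the bound true on the inner part of the shell, where the
    norm is below 1.\<close>
  define C where "C = B / \<rho> ^ M"
  have "norm (g z) \<le> C * norm z ^ M" if "\<rho> \<le> norm z" "r ^ k * norm z \<le> 1" for k z
    using that
  proof (induction k arbitrary: z)
    case 0
    then have "norm (g z) \<le> B"
      by (intro B(2)) (simp add: K_def)
    also have "\<dots> = C * \<rho> ^ M"
      using \<rho>(1) by (simp add: C_def)
    also have "\<dots> \<le> C * norm z ^ M"
      using 0 \<rho>(1) B(1) by (intro mult_left_mono power_mono) (auto simp: C_def)
    finally show ?case .
  next
    case (Suc k)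
    show ?case
    proof (cases "norm z \<le> 1")
      case True
      have "r ^ k * norm z \<le> 1"
        using True r(1) r0 by (simp add: mult_le_one power_le_one)
      then show ?thesis
        using Suc by blast
    next
      case False
      let ?w = "hopf_map \<mu> z"
      have up: "norm ?w \<le> r * norm z" and low: "\<rho> * norm z \<le> norm ?w"
        using norm_hopf_map_le[OF r(2)] norm_hopf_map_ge[OF \<rho>(2)] r0 \<rho>(1) by auto
      have "\<rho> \<le> \<rho> * norm z"
        using False \<rho>(1) by simp
      then have w: "\<rho> \<le> norm ?w"
        using low by linarith
      have "r ^ k * norm ?w \<le> r ^ k * (r * norm z)"
        using up r0 by (intro mult_left_mono) auto
      then have "r ^ k * norm ?w \<le> 1"
        using Suc.prems(2) by (simp add: mult_ac)
      from Suc.IH[OF w this] have "norm (g ?w) \<le> C * norm ?w ^ M" .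
      also have "\<dots> \<le> C * (r * norm z) ^ M"
        using up B(1) \<rho>(1) by (intro mult_left_mono power_mono) (auto simp: C_def)
      also have "\<dots> = r ^ M * (C * norm z ^ M)"
        by (simp add: power_mult_distrib mult_ac)
      also have "\<dots> \<le> norm \<kappa> * (C * norm z ^ M)"
        using M B(1) \<rho>(1) by (intro mult_right_mono) (auto simp: C_def)
      finally have "norm \<kappa> * norm (g z) \<le> norm \<kappa> * (C * norm z ^ M)"
        using eig[OF KW[OF Suc.prems(1)]] by (simp add: norm_mult)
      then show ?thesis
        using \<open>\<kappa> \<noteq> 0\<close> by simp
    qed
  qed
  note bound = this
  show thesis
  proof (rule that[of C M])
    show "0 \<le> C"
      using B(1) \<rho>(1) by (simp add: C_def)
    fix z :: "complex ^ 'n"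
    assume z: "1 \<le> norm z"
    then have pos: "0 < norm z"
      by linarith
    then obtain k where "r ^ k < 1 / norm z"
      using real_arch_pow_inv[of "1 / norm z" r] r(1) by auto
    then have "r ^ k * norm z \<le> 1"
      unfolding pos_less_divide_eq[OF pos] by simp
    with z \<rho>1 bound show "norm (g z) \<le> C * norm z ^ M"
      by (meson order.trans)
  qed
qed

text \<open>
  This is where the dimension enters: on the line in direction \<open>i\<close> through a point of the torus some
  other coordinate is a nonzero constant, so the line stays in \<open>W\<close> and the restriction of \<open>g\<close> is
  entire. Liouville's theorem for functions of polynomial growth applies.
\<close>

lemma hopf_eigenfunction_polynomial_in_coord:
  fixes g :: "complex ^ 'n::finite \<Rightarrow> complex"
  assumes "CARD('n) \<ge> 2" and g: "holo_fun_on g W"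
    and growth: "0 \<le> C" "\<And>z. 1 \<le> norm z \<Longrightarrow> norm (g z) \<le> C * norm z ^ M"
    and z: "z \<in> torus"
  shows "\<exists>p. degree p \<le> M \<and> (\<forall>t. g (set_coord z i t) = poly p t)"
proof -
  obtain j where "j \<noteq> i"
  proof -
    have "card (UNIV - {i}) \<noteq> 0"
      using assms(1) by (subst card_Diff_singleton) auto
    then have "UNIV - {i} \<noteq> {}"
      by force
    then show thesis
      using that by auto
  qed
  then have "set_coord z i t $ j \<noteq> 0" for t
    using z by (simp add: set_coord_nth torus_def)
  then have "set_coord z i t \<in> W" for t
    unfolding W_def by (metis DiffI UNIV_I singletonD zero_index)
  then have holo: "(\<lambda>t. g (set_coord z i t)) holomorphic_on UNIV"
    using holomorphic_set_coord[OF g] by blast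
  let ?R = "1 + norm (set_coord z i 0)"
  have norm_axis: "norm (axis i t :: complex ^ 'n) = norm t" for t
    by (simp add: norm_vec_def L2_set_def axis_def if_distrib[of norm]
        if_distrib[of "\<lambda>x. x\<^sup>2"] cong: if_cong)
  have bound: "norm (g (set_coord z i t)) \<le> (C * ?R ^ M) * norm t ^ M" if t: "1 \<le> norm t" for t
  proof -
    have "norm t \<le> norm (set_coord z i t)"
      using Finite_Cartesian_Product.norm_nth_le[of "set_coord z i t" i] by (simp add: set_coord_nth)
    then have "norm (g (set_coord z i t)) \<le> C * norm (set_coord z i t) ^ M"
      using t by (intro growth(2)) linarith
    also have "\<dots> \<le> C * (?R * norm t) ^ M"
    proof -
      have "set_coord z i t = axis i t + set_coord z i 0"
        by (simp add: vec_eq_iff set_coord_nth axis_def)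
      then have "norm (set_coord z i t) \<le> norm t + norm (set_coord z i 0)"
        using norm_triangle_ineq[of "axis i t" "set_coord z i 0"] norm_axis by simp
      also have "\<dots> \<le> norm t + norm (set_coord z i 0) * norm t"
        using t by (simp add: mult_le_cancel_left1)
      finally show ?thesis
        using growth(1) by (intro mult_left_mono power_mono) (auto simp: algebra_simps)
    qed
    finally show ?thesis
      by (simp add: power_mult_distrib mult_ac)
  qed
  let ?c = "\<lambda>k. (deriv ^^ k) (\<lambda>t. g (set_coord z i t)) 0 / fact k"
  have "g (set_coord z i t) = poly (\<Sum>k\<le>M. monom (?c k) k) t" for t
    using Liouville_polynomial[OF holo, of 1 "C * ?R ^ M" M t] bound by (simp add: poly_sum poly_monom)
  moreover have "degree (\<Sum>k\<le>M. monom (?c k) k) \<le> M"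
    by (intro degree_sum_le) (auto intro: order.trans[OF degree_monom_le])
  ultimately show ?thesis
    by blast
qed

text \<open>
  Once \<open>g\<close> is known to be a polynomial \<open>\<Sum> c\<^sub>\<alpha> z^\<alpha>\<close>, the unwanted monomials are removed without
  appealing to uniqueness of coefficients. Precomposition with \<open>f\<close> multiplies \<open>z^\<alpha>\<close> by \<open>e \<alpha> = \<mu>^\<alpha>\<close> and
  \<open>g\<close> by \<open>\<kappa>\<close>; applying a polynomial \<open>p\<close> in this operator therefore gives
  \<open>p(\<kappa>) g = \<Sum> p(e \<alpha>) c\<^sub>\<alpha> z^\<alpha>\<close>. Choose \<open>p\<close> to vanish at all the \<open>e \<alpha>\<close> that differ from \<open>\<kappa>\<close>, but not at
  \<open>\<kappa>\<close>.
\<close>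

theorem hopf_eigenfunction_is_monomial:
  fixes g :: "complex ^ 'n::finite \<Rightarrow> complex"
  assumes card: "CARD('n) \<ge> 2"
    and \<mu>: "\<And>i. 0 < norm (\<mu> i)" "\<And>i. norm (\<mu> i) < 1"
    and indep: "\<And>\<alpha> \<beta> :: 'n \<Rightarrow> nat.
                  (\<Prod>i\<in>UNIV. \<mu> i ^ \<alpha> i) = (\<Prod>i\<in>UNIV. \<mu> i ^ \<beta> i) \<Longrightarrow> \<alpha> = \<beta>"
    and "\<kappa> \<noteq> 0" and g: "holo_fun_on g W"
    and eig: "\<And>z. z \<in> W \<Longrightarrow> g (hopf_map \<mu> z) = \<kappa> * g z"
  shows "\<exists>c \<alpha>. (\<forall>z\<in>W. g z = c * mono_fun \<alpha> z) \<and> (c \<noteq> 0 \<longrightarrow> (\<Prod>i\<in>UNIV. \<mu> i ^ \<alpha> i) = \<kappa>)"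
proof -
  obtain C M where growth: "0 \<le> C" "\<And>z. 1 \<le> norm z \<Longrightarrow> norm (g z) \<le> C * norm z ^ M"
    using hopf_eigenfunction_growth[OF \<mu> \<open>\<kappa> \<noteq> 0\<close> g eig] by blast
  have "\<exists>h. poly_fun h \<and> (\<forall>z\<in>torus. g z = h z)"
  proof (rule poly_fun_if_separately_polynomial[of UNIV])
    show "\<exists>p. degree p \<le> M \<and> (\<forall>t. t \<noteq> 0 \<longrightarrow> g (set_coord z i t) = poly p t)"
      if "z \<in> torus" for z i
      using hopf_eigenfunction_polynomial_in_coord[OF card g growth that, of i] by blast
  qed (simp_all add: vec_eq_iff[symmetric])
  then obtain I c where I: "finite I" "\<And>z. z \<in> torus \<Longrightarrow> g z = (\<Sum>\<alpha>\<in>I. c \<alpha> * mono_fun \<alpha> z)"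
    unfolding poly_fun_def by auto
  have g_eq: "g z = (\<Sum>\<alpha>\<in>I. c \<alpha> * mono_fun \<alpha> z)" if z: "z \<in> W" for z
  proof -
    have "isCont (\<lambda>z. g z - (\<Sum>\<alpha>\<in>I. c \<alpha> * mono_fun \<alpha> z)) z"
      by (intro continuous_intros isCont_mono_fun holo_fun_on_isCont[OF g z])
    then have "g z - (\<Sum>\<alpha>\<in>I. c \<alpha> * mono_fun \<alpha> z) = 0"
      by (rule zero_if_zero_on_torus) (simp add: I(2))
    then show ?thesis
      by simp
  qed
  define e where "e = (\<lambda>\<alpha>. \<Prod>i\<in>UNIV. \<mu> i ^ \<alpha> i)"
  define p where "p = (\<Prod>v\<in>e ` I - {\<kappa>}. [:- v, 1:])"
  have p_lam: "poly p \<kappa> \<noteq> 0"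
    unfolding p_def poly_prod using I(1) by auto
  have p_e: "poly p (e \<alpha>) = 0" if "\<alpha> \<in> I" "e \<alpha> \<noteq> \<kappa>" for \<alpha>
    unfolding p_def poly_prod using I(1) that by (intro prod_zero bexI[of _ "e \<alpha>"]) auto
  have \<mu>0: "\<mu> i \<noteq> 0" for i
    using \<mu>(1)[of i] by auto
  have iter_W: "(hopf_map \<mu> ^^ k) z \<in> W" if "z \<in> W" for z k
    using that by (induction k) (simp_all add: hopf_map_in_W \<mu>0)
  have iter_g: "g ((hopf_map \<mu> ^^ k) z) = \<kappa> ^ k * g z" if "z \<in> W" for z k
    using that by (induction k) (simp_all add: eig iter_W)
  have iter_mono: "mono_fun \<alpha> ((hopf_map \<mu> ^^ k) z) = e \<alpha> ^ k * mono_fun \<alpha> z" for \<alpha> z k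
    by (induction k) (simp_all add: mono_fun_hopf_map e_def)
  define I' where "I' = {\<alpha>\<in>I. e \<alpha> = \<kappa>}"
  have g': "g z = (\<Sum>\<alpha>\<in>I'. c \<alpha> * mono_fun \<alpha> z)" if z: "z \<in> W" for z
  proof -
    have "poly p \<kappa> * g z = (\<Sum>k\<le>degree p. coeff p k * g ((hopf_map \<mu> ^^ k) z))"
      by (simp add: iter_g z poly_altdef sum_distrib_right mult.assoc)
    also have "\<dots> = (\<Sum>k\<le>degree p. coeff p k * (\<Sum>\<alpha>\<in>I. c \<alpha> * (e \<alpha> ^ k * mono_fun \<alpha> z)))"
      by (simp add: g_eq iter_W z iter_mono)
    also have "\<dots> = (\<Sum>\<alpha>\<in>I. \<Sum>k\<le>degree p. coeff p k * (c \<alpha> * (e \<alpha> ^ k * mono_fun \<alpha> z)))"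
      by (subst sum.swap) (simp add: sum_distrib_left)
    also have "\<dots> = (\<Sum>\<alpha>\<in>I. poly p (e \<alpha>) * (c \<alpha> * mono_fun \<alpha> z))"
      by (simp add: poly_altdef sum_distrib_right) (simp only: mult_ac)
    also have "\<dots> = (\<Sum>\<alpha>\<in>I'. poly p \<kappa> * (c \<alpha> * mono_fun \<alpha> z))"
      using I(1) p_e by (intro sum.mono_neutral_cong_right) (auto simp: I'_def)
    finally show ?thesis
      using p_lam by (simp add: sum_distrib_left[symmetric])
  qed
  show ?thesis
  proof (cases "I' = {}")
    case True
    then show ?thesis
      using g' by (intro exI[of _ 0]) simp
  next
    case False
    then obtain \<alpha> where \<alpha>: "\<alpha> \<in> I'"
      by blast
    then have "I' = {\<alpha>}"
      using indep unfolding I'_def e_def by fastforce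
    moreover have "(\<Prod>i\<in>UNIV. \<mu> i ^ \<alpha> i) = \<kappa>"
      using \<alpha> by (simp add: I'_def e_def)
    ultimately show ?thesis
      using g' by (intro exI[of _ "c \<alpha>"] exI[of _ \<alpha>]) simp
  qed
qed

text \<open>
  Cancelling the common factor \<open>\<mu>^min(\<alpha>,\<beta>)\<close> puts an arbitrary coincidence of monomials into the form
  with disjoint index sets that genericity speaks about.
\<close>

lemma generic_hopf_independent:
  assumes gen: "generic_hopf \<mu>"
    and eq: "(\<Prod>i\<in>UNIV. \<mu> i ^ \<alpha> i) = (\<Prod>i\<in>UNIV. \<mu> i ^ \<beta> i)"
  shows "\<alpha> = \<beta>"
proof -
  define A where "A = {i. \<beta> i \<le> \<alpha> i}"
  define r where "r = (\<lambda>i. if i \<in> A then \<alpha> i - \<beta> i else \<beta> i - \<alpha> i)"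
  have \<mu>0: "\<mu> i \<noteq> 0" for i
    using gen unfolding generic_hopf_def by force
  let ?m = "\<Prod>i\<in>UNIV. \<mu> i ^ min (\<alpha> i) (\<beta> i)"
  have split: "prod h UNIV = prod h A * prod h (- A)" for h :: "'a \<Rightarrow> complex"
    using prod.union_disjoint[of A "- A" h] by simp
  have add: "(\<Prod>i\<in>B. \<mu> i ^ min (\<alpha> i) (\<beta> i)) * (\<Prod>i\<in>B. \<mu> i ^ r i) = (\<Prod>i\<in>B. \<mu> i ^ \<gamma> i)"
    if "\<And>i. i \<in> B \<Longrightarrow> min (\<alpha> i) (\<beta> i) + r i = \<gamma> i" for B \<gamma>
    unfolding prod.distrib[symmetric] power_add[symmetric] using that by (intro prod.cong) auto
  have "?m * (\<Prod>i\<in>A. \<mu> i ^ r i) = (\<Prod>i\<in>-A. \<mu> i ^ min (\<alpha> i) (\<beta> i)) * (\<Prod>i\<in>A. \<mu> i ^ \<alpha> i)"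
  proof -
    have "(\<Prod>i\<in>A. \<mu> i ^ min (\<alpha> i) (\<beta> i)) * (\<Prod>i\<in>A. \<mu> i ^ r i) = (\<Prod>i\<in>A. \<mu> i ^ \<alpha> i)"
      by (rule add) (auto simp: r_def A_def)
    from this[symmetric] show ?thesis
      unfolding split[of "\<lambda>i. \<mu> i ^ min (\<alpha> i) (\<beta> i)"] by (simp only: mult_ac)
  qed
  also have "(\<Prod>i\<in>-A. \<mu> i ^ min (\<alpha> i) (\<beta> i)) = (\<Prod>i\<in>-A. \<mu> i ^ \<alpha> i)"
    by (intro prod.cong) (auto simp: A_def)
  also have "\<dots> * (\<Prod>i\<in>A. \<mu> i ^ \<alpha> i) = (\<Prod>i\<in>UNIV. \<mu> i ^ \<alpha> i)"
    unfolding split[of "\<lambda>i. \<mu> i ^ \<alpha> i"] by (rule mult.commute)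
  also note eq
  also have "(\<Prod>i\<in>UNIV. \<mu> i ^ \<beta> i) = (\<Prod>i\<in>A. \<mu> i ^ \<beta> i) * (\<Prod>i\<in>-A. \<mu> i ^ \<beta> i)"
    by (rule split)
  also have "(\<Prod>i\<in>A. \<mu> i ^ \<beta> i) = (\<Prod>i\<in>A. \<mu> i ^ min (\<alpha> i) (\<beta> i))"
    by (intro prod.cong) (auto simp: A_def)
  also have "(\<Prod>i\<in>-A. \<mu> i ^ \<beta> i) = (\<Prod>i\<in>-A. \<mu> i ^ min (\<alpha> i) (\<beta> i)) * (\<Prod>i\<in>-A. \<mu> i ^ r i)"
    by (rule add[symmetric]) (auto simp: r_def A_def)
  finally have "?m * (\<Prod>i\<in>A. \<mu> i ^ r i) = ?m * (\<Prod>i\<in>-A. \<mu> i ^ r i)"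
    unfolding split[of "\<lambda>i. \<mu> i ^ min (\<alpha> i) (\<beta> i)"] by (simp only: mult.assoc)
  moreover have "?m \<noteq> 0"
    using \<mu>0 by simp
  ultimately have "(\<Prod>i\<in>A. \<mu> i ^ r i) = (\<Prod>j\<in>-A. \<mu> j ^ r j)"
    by simp
  then have "\<forall>i. r i = 0"
    using gen unfolding generic_hopf_def by (metis Compl_disjoint Compl_partition)
  then show ?thesis
    by (auto simp: fun_eq_iff r_def A_def split: if_splits)
qed


section \<open>From bundle morphisms to equivariant 1-forms\<close>

lemma orbit_class_eq_iff:
  assumes "p \<in> S" "q \<in> S"
  shows "orbit_class S F p = orbit_class S F q \<longleftrightarrow> (\<exists>m k. (F ^^ m) p = (F ^^ k) q)"
proof
  assume "orbit_class S F p = orbit_class S F q"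
  moreover have "q \<in> orbit_class S F q"
    using assms by (auto simp: orbit_class_def orbit_rel_def)
  ultimately have "q \<in> orbit_class S F p"
    by simp
  then show "\<exists>m k. (F ^^ m) p = (F ^^ k) q"
    by (auto simp: orbit_class_def orbit_rel_def)
next
  have commute: "(F ^^ i) ((F ^^ j) x) = (F ^^ j) ((F ^^ i) x)" for i j x
    by (simp add: funpow_add[symmetric, THEN fun_cong, unfolded comp_def] add.commute)
  have step: "\<exists>a b. (F ^^ a) q = (F ^^ b) x"
    if "(F ^^ m) p = (F ^^ k) q" "(F ^^ a) p = (F ^^ b) x" for p q x m k a b
  proof -
    have "(F ^^ a) ((F ^^ k) q) = (F ^^ m) ((F ^^ b) x)"
      using that commute[of a m p] by simp
    then show ?thesis
      by (metis funpow_add comp_apply)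
  qed
  assume "\<exists>m k. (F ^^ m) p = (F ^^ k) q"
  then obtain m k where mk: "(F ^^ m) p = (F ^^ k) q"
    by blast
  then show "orbit_class S F p = orbit_class S F q"
    unfolding orbit_class_def orbit_rel_def
    using assms step[OF mk] step[OF mk[symmetric]] by blast
qed

lemma hopf_proj_eq_iff:
  assumes "z \<in> W" "w \<in> W"
  shows "hopf_proj \<mu> z = hopf_proj \<mu> w \<longleftrightarrow> (\<exists>m k. (hopf_map \<mu> ^^ m) z = (hopf_map \<mu> ^^ k) w)"
  unfolding hopf_proj_def using orbit_class_eq_iff[OF assms] .

lemma line_pt_eqI:
  assumes "z \<in> W" "w \<in> W" "(hopf_map \<mu> ^^ m) z = (hopf_map \<mu> ^^ k) w" "b ^ m * v = b ^ k * v'"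
  shows "line_pt \<mu> b z v = line_pt \<mu> b w v'"
proof -
  have iter: "((\<lambda>(z, v). (hopf_map \<mu> z, b * v)) ^^ k) (z, v) = ((hopf_map \<mu> ^^ k) z, b ^ k * v)"
    for k z v
    by (induction k) (simp_all add: mult_ac)
  show ?thesis
    unfolding line_pt_def using assms
    by (subst orbit_class_eq_iff) (simp_all add: iter, rule exI[of _ m], rule exI[of _ k], simp)
qed

lemma cotangent_pt_eq_iff:
  assumes "z \<in> W" "w \<in> W" "clinear_form \<alpha>" "clinear_form \<beta>"
  shows "cotangent_pt \<mu> z \<alpha> = cotangent_pt \<mu> w \<beta> \<longleftrightarrow>
    (\<exists>m k. (hopf_map \<mu> ^^ m) z = (hopf_map \<mu> ^^ k) w \<and>
      \<alpha> \<circ> hopf_map (\<lambda>i. inverse (\<mu> i) ^ m) = \<beta> \<circ> hopf_map (\<lambda>i. inverse (\<mu> i) ^ k))"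
proof -
  have iter: "((\<lambda>(z, \<alpha>). (hopf_map \<mu> z, \<alpha> \<circ> hopf_map (\<lambda>i. inverse (\<mu> i)))) ^^ k) (z, \<alpha>) =
      ((hopf_map \<mu> ^^ k) z, \<alpha> \<circ> hopf_map (\<lambda>i. inverse (\<mu> i) ^ k))"
    for k z and \<alpha> :: "complex ^ 'a \<Rightarrow> complex"
    by (induction k) (simp_all add: fun_eq_iff hopf_map_def mult_ac)
  show ?thesis
    unfolding cotangent_pt_def using assms by (subst orbit_class_eq_iff) (simp_all add: iter)
qed

lemma hopf_map_free:
  assumes \<mu>: "\<And>i. 0 < norm (\<mu> i)" "\<And>i. norm (\<mu> i) < 1"
    and z: "z \<in> W" and eq: "(hopf_map \<mu> ^^ m) z = (hopf_map \<mu> ^^ k) z"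
  shows "m = k"
proof -
  obtain j where "z $ j \<noteq> 0"
    using z by (auto simp: W_def vec_eq_iff)
  then have "\<mu> j ^ m = \<mu> j ^ k"
    using eq by (auto simp: hopf_map_iter vec_eq_iff hopf_map_nth)
  then have "norm (\<mu> j) ^ m = norm (\<mu> j) ^ k"
    by (simp flip: norm_power)
  then show ?thesis
    using power_strict_decreasing[OF _ \<mu>(1)[of j] \<mu>(2)[of j]]
    by (metis less_irrefl nat_neq_iff)
qed

text \<open>
  Two covectors at the same point of \<open>W\<close> that represent the same covector on the quotient are related by
  an iterate of \<open>f\<close> fixing that point, and a contraction fixes no point of \<open>W\<close>. This makes the
  pulled-back form well defined.
\<close>

lemma cotangent_pt_inject:
  assumes \<mu>: "\<And>i. 0 < norm (\<mu> i)" "\<And>i. norm (\<mu> i) < 1"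
    and "z \<in> W" "clinear_form \<alpha>" "clinear_form \<beta>"
    and eq: "cotangent_pt \<mu> z \<alpha> = cotangent_pt \<mu> z \<beta>"
  shows "\<alpha> = \<beta>"
proof
  fix u
  obtain m k where mk: "(hopf_map \<mu> ^^ m) z = (hopf_map \<mu> ^^ k) z"
    "\<alpha> \<circ> hopf_map (\<lambda>i. inverse (\<mu> i) ^ m) = \<beta> \<circ> hopf_map (\<lambda>i. inverse (\<mu> i) ^ k)"
    using eq cotangent_pt_eq_iff assms by metis
  have "m = k"
    using hopf_map_free[OF \<mu> \<open>z \<in> W\<close> mk(1)] .
  moreover have "hopf_map (\<lambda>i. inverse (\<mu> i) ^ k) (hopf_map (\<lambda>i. \<mu> i ^ k) u) = u"
    using \<mu>(1) by (simp add: vec_eq_iff hopf_map_nth power_inverse)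
  ultimately show "\<alpha> u = \<beta> u"
    using mk(2) by (metis comp_apply)
qed

lemma clinear_form_scale_hopf_map:
  "clinear_form \<alpha> \<Longrightarrow> clinear_form (\<lambda>u. c * \<alpha> (hopf_map \<nu> u))"
proof -
  have "hopf_map \<nu> (x + y) = hopf_map \<nu> x + hopf_map \<nu> y"
    "hopf_map \<nu> (c *s x) = c *s hopf_map \<nu> x" for x y c
    by (simp_all add: vec_eq_iff hopf_map_nth algebra_simps)
  then show "clinear_form \<alpha> \<Longrightarrow> clinear_form (\<lambda>u. c * \<alpha> (hopf_map \<nu> u))"
    by (simp add: clinear_form_iff algebra_simps)
qed

lemma clinear_form_scale: "clinear_form \<alpha> \<Longrightarrow> clinear_form (\<lambda>u. c * \<alpha> u)"
  by (simp add: clinear_form_iff algebra_simps)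

lemma bounded_linear_hopf_map: "bounded_linear (hopf_map \<nu> :: complex ^ 'n::finite \<Rightarrow> _)"
  by (intro linear_conv_bounded_linear[THEN iffD1] linearI)
    (simp_all add: vec_eq_iff hopf_map_nth algebra_simps)

lemma cotangent_pt_transport:
  assumes "\<And>i. \<mu> i \<noteq> 0" "z \<in> W" "w \<in> W" "clinear_form \<alpha>"
    and eq: "(hopf_map \<mu> ^^ m) z = (hopf_map \<mu> ^^ k) w"
  shows "cotangent_pt \<mu> w \<alpha> = cotangent_pt \<mu> z (\<lambda>u. \<alpha> (hopf_map (\<lambda>i. \<mu> i ^ m / \<mu> i ^ k) u))"
proof -
  have "hopf_map (\<lambda>i. \<mu> i ^ m / \<mu> i ^ k) (hopf_map (\<lambda>i. inverse (\<mu> i) ^ m) u) =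
      hopf_map (\<lambda>i. inverse (\<mu> i) ^ k) u" for u
    using assms(1) by (simp add: vec_eq_iff hopf_map_nth power_inverse field_simps)
  then show ?thesis
    using clinear_form_scale_hopf_map[OF assms(4), of 1] assms
    by (subst cotangent_pt_eq_iff) (simp_all add: fun_eq_iff, rule exI[of _ k], rule exI[of _ m], simp)
qed

text \<open>
  The definition of a morphism supplies a form \<open>g\<close> near some point \<open>w\<close> of the orbit of \<open>z\<close> only. It is
  carried to a neighbourhood of \<open>z\<close> by \<open>H = f^(m-k)\<close>, where \<open>f^m z = f^k w\<close>; since \<open>H\<close> is again a
  diagonal map, negative exponents cause no trouble. The factor \<open>b ^ m / b ^ k\<close> is the action on the fibre
  of \<open>L\<^sub>b\<close>.
\<close>

lemma bundle_morphism_local_form: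
  fixes \<mu> :: "'n::finite \<Rightarrow> complex"
  assumes \<mu>0: "\<And>i. \<mu> i \<noteq> 0" and "b \<noteq> 0" and "bundle_morphism \<mu> b \<phi>" and z: "z \<in> W"
  shows "\<exists>V \<theta>. open V \<and> z \<in> V \<and> V \<subseteq> W \<and> holo_one_form_on \<theta> V \<and>
    (\<forall>x\<in>V. \<forall>v. \<phi> (line_pt \<mu> b x v) = cotangent_pt \<mu> x (\<lambda>u. v * \<theta> x u))"
proof -
  have "hopf_proj \<mu> z \<in> hopf_manifold \<mu>"
    using z unfolding hopf_proj_def orbit_class_def hopf_manifold_def by (rule quotientI)
  with assms(3) have "\<exists>U g. open U \<and> U \<subseteq> W \<and> inj_on (hopf_proj \<mu>) U \<and>
      hopf_proj \<mu> z \<in> hopf_proj \<mu> ` U \<and> holo_one_form_on g U \<and>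
      (\<forall>y\<in>U. \<forall>v. \<phi> (line_pt \<mu> b y v) = cotangent_pt \<mu> y (\<lambda>u. v * g y u))"
    unfolding bundle_morphism_def by (rule bspec)
  then obtain U g where U: "open U" "U \<subseteq> W" and zU: "hopf_proj \<mu> z \<in> hopf_proj \<mu> ` U"
    and g: "holo_one_form_on g U"
    and \<phi>: "\<forall>y\<in>U. \<forall>v. \<phi> (line_pt \<mu> b y v) = cotangent_pt \<mu> y (\<lambda>u. v * g y u)"
    by (elim exE conjE)
  from zU obtain w where w: "hopf_proj \<mu> z = hopf_proj \<mu> w" "w \<in> U"
    by (rule imageE)
  obtain m k where mk: "(hopf_map \<mu> ^^ m) z = (hopf_map \<mu> ^^ k) w"
    using w U(2) z hopf_proj_eq_iff by blast
  define H where "H = hopf_map (\<lambda>i. \<mu> i ^ m / \<mu> i ^ k)"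
  have iter_H: "(hopf_map \<mu> ^^ m) x = (hopf_map \<mu> ^^ k) (H x)" for x
    using \<mu>0 by (simp add: H_def hopf_map_iter vec_eq_iff hopf_map_nth)
  define V where "V = H -` U"
  define \<theta> where "\<theta> = (\<lambda>x u. (b ^ m / b ^ k) * g (H x) (H u))"
  have H_deriv: "(H has_derivative H) (at x)" for x
    unfolding H_def by (rule bounded_linear_imp_has_derivative[OF bounded_linear_hopf_map])
  have "open V"
    unfolding V_def H_def
    by (intro open_vimage U(1) linear_continuous_on bounded_linear_hopf_map)
  moreover have "z \<in> V"
  proof -
    have "H z $ i = w $ i" for i
    proof -
      have "\<mu> i ^ m * z $ i = \<mu> i ^ k * w $ i"
        using mk by (simp add: hopf_map_iter vec_eq_iff hopf_map_nth)
      then show ?thesis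
        by (simp add: H_def hopf_map_nth \<mu>0)
    qed
    then have "H z = w"
      by (simp add: vec_eq_iff)
    then show ?thesis
      using w by (simp add: V_def)
  qed
  moreover have VW: "V \<subseteq> W"
  proof
    fix x assume "x \<in> V"
    then have "H x \<in> W"
      using U(2) by (auto simp: V_def)
    then show "x \<in> W"
      unfolding H_def using \<mu>0 by (subst (asm) hopf_map_in_W) simp_all
  qed
  moreover have "holo_one_form_on \<theta> V"
    unfolding holo_one_form_on_def holo_fun_on_def
  proof (intro conjI ballI allI)
    fix x assume x: "x \<in> V"
    then have "clinear_form (g (H x))"
      using g by (simp add: holo_one_form_on_def V_def)
    then show "clinear_form (\<theta> x)"
      unfolding \<theta>_def H_def by (rule clinear_form_scale_hopf_map)
    fix u
    obtain D where D: "clinear_form D" "((\<lambda>y. g y (H u)) has_derivative D) (at (H x))"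
      using g x unfolding holo_one_form_on_def holo_fun_on_def V_def by blast
    have "((\<lambda>y. g (H y) (H u)) has_derivative (\<lambda>t. D (H t))) (at x)"
      by (rule has_derivative_compose[OF H_deriv D(2)])
    then have "((\<lambda>y. \<theta> y u) has_derivative (\<lambda>t. (b ^ m / b ^ k) * D (H t))) (at x)"
      unfolding \<theta>_def by (rule has_derivative_mult_right)
    moreover have "clinear_form (\<lambda>t. (b ^ m / b ^ k) * D (H t))"
      unfolding H_def using D(1) by (rule clinear_form_scale_hopf_map)
    ultimately show "\<exists>D. clinear_form D \<and> ((\<lambda>y. \<theta> y u) has_derivative D) (at x)"
      by blast
  qed
  moreover have "\<phi> (line_pt \<mu> b x v) = cotangent_pt \<mu> x (\<lambda>u. v * \<theta> x u)" if x: "x \<in> V" for x v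
  proof -
    have xW: "x \<in> W" and HU: "H x \<in> U" and HW: "H x \<in> W"
      using x VW U(2) by (auto simp: V_def)
    have "clinear_form (g (H x))"
      using g HU by (simp add: holo_one_form_on_def)
    then have lin: "clinear_form (\<lambda>u. (b ^ m / b ^ k * v) * g (H x) u)"
      by (rule clinear_form_scale)
    have "line_pt \<mu> b x v = line_pt \<mu> b (H x) (b ^ m / b ^ k * v)"
      using \<open>b \<noteq> 0\<close> by (intro line_pt_eqI[OF xW HW iter_H]) simp
    then have "\<phi> (line_pt \<mu> b x v) = cotangent_pt \<mu> (H x) (\<lambda>u. (b ^ m / b ^ k * v) * g (H x) u)"
      using \<phi> HU by simp
    also have "\<dots> = cotangent_pt \<mu> x (\<lambda>u. (b ^ m / b ^ k * v) * g (H x) (H u))"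
      using cotangent_pt_transport[where \<mu> = \<mu>, OF \<mu>0 xW HW lin iter_H] by (simp add: H_def)
    finally show ?thesis
      by (simp add: \<theta>_def mult_ac)
  qed
  ultimately show ?thesis
    by (intro exI[of _ V] exI[of _ \<theta>]) simp
qed

text \<open>
  The local forms agree with each other because the covector representing \<open>\<phi>\<close> at a point of \<open>W\<close> is
  unique, so the pointwise choice of such a covector is holomorphic.
\<close>

lemma bundle_morphism_induced:
  fixes \<mu> :: "'n::finite \<Rightarrow> complex"
  assumes \<mu>: "\<And>i. 0 < norm (\<mu> i)" "\<And>i. norm (\<mu> i) < 1"
    and "b \<noteq> 0" and "bundle_morphism \<mu> b \<phi>"
  shows "\<exists>\<omega>. induced_by \<mu> b \<phi> \<omega>"
proof -
  have \<mu>0: "\<mu> i \<noteq> 0" for i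
    using \<mu>(1)[of i] by auto
  define P where "P = (\<lambda>z \<alpha>. clinear_form \<alpha> \<and>
    (\<forall>v. \<phi> (line_pt \<mu> b z v) = cotangent_pt \<mu> z (\<lambda>u. v * \<alpha> u)))"
  have unique: "\<alpha> = \<beta>" if "z \<in> W" "P z \<alpha>" "P z \<beta>" for z \<alpha> \<beta>
  proof -
    have "cotangent_pt \<mu> z (\<lambda>u. 1 * \<alpha> u) = cotangent_pt \<mu> z (\<lambda>u. 1 * \<beta> u)"
      using that unfolding P_def by metis
    then show ?thesis
      using that by (intro cotangent_pt_inject[where \<mu> = \<mu> and z = z, OF \<mu>]) (simp_all add: P_def)
  qed
  define \<omega> where "\<omega> = (\<lambda>z. SOME \<alpha>. P z \<alpha>)"
  have loc: "\<exists>V \<theta>. open V \<and> z \<in> V \<and> holo_one_form_on \<theta> V \<and> (\<forall>x\<in>V. P x (\<theta> x) \<and> \<omega> x = \<theta> x)"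
    if z: "z \<in> W" for z
  proof -
    obtain V \<theta> where V: "open V" "z \<in> V" "V \<subseteq> W" "holo_one_form_on \<theta> V"
      "\<And>x v. x \<in> V \<Longrightarrow> \<phi> (line_pt \<mu> b x v) = cotangent_pt \<mu> x (\<lambda>u. v * \<theta> x u)"
      using bundle_morphism_local_form[OF \<mu>0 assms(3,4) z] by blast
    have on_V: "P x (\<theta> x) \<and> \<omega> x = \<theta> x" if x: "x \<in> V" for x
    proof -
      have P: "P x (\<theta> x)"
        using V x unfolding P_def holo_one_form_on_def by blast
      moreover have "P x (\<omega> x)"
        unfolding \<omega>_def by (rule someI[of "P x" "\<theta> x", OF P])
      ultimately show ?thesis
        using unique x V(3) by blast
    qed
    show ?thesis
    proof (rule exI[of _ V], rule exI[of _ \<theta>], intro conjI ballI)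
      show "P x (\<theta> x)" "\<omega> x = \<theta> x" if "x \<in> V" for x
        using on_V[OF that] by blast+
    qed (rule V(1) V(2) V(4))+
  qed
  have "holo_one_form_on \<omega> W"
    unfolding holo_one_form_on_def holo_fun_on_def
  proof (intro conjI ballI allI)
    fix z :: "complex ^ 'n" and u
    assume "z \<in> W"
    from loc[OF this] obtain V \<theta> where V: "open V" "z \<in> V" "holo_one_form_on \<theta> V"
      and on_V: "\<forall>x\<in>V. P x (\<theta> x) \<and> \<omega> x = \<theta> x"
      by (elim exE conjE)
    show "clinear_form (\<omega> z)"
      using V on_V by (simp add: holo_one_form_on_def)
    obtain D where D: "clinear_form D" "((\<lambda>x. \<theta> x u) has_derivative D) (at z)"
      using V unfolding holo_one_form_on_def holo_fun_on_def by blast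
    have "((\<lambda>x. \<omega> x u) has_derivative D) (at z)"
      using on_V by (intro has_derivative_transform_within_open[OF D(2) V(1,2)]) simp
    then show "\<exists>D. clinear_form D \<and> ((\<lambda>x. \<omega> x u) has_derivative D) (at z)"
      using D(1) by blast
  qed
  moreover have "\<phi> (line_pt \<mu> b z v) = cotangent_pt \<mu> z (\<lambda>u. v * \<omega> z u)" if "z \<in> W" for z v
    using loc[OF that] by (auto simp: P_def)
  ultimately show ?thesis
    unfolding induced_by_def by blast
qed

text \<open>
  Evaluate \<open>\<phi>\<close> on one vector of \<open>L\<^sub>b\<close> through its two representatives \<open>(z, 1)\<close> and \<open>(f z, b)\<close>.
\<close>

lemma induced_by_equivariant:
  fixes \<mu> :: "'n::finite \<Rightarrow> complex"
  assumes \<mu>: "\<And>i. 0 < norm (\<mu> i)" "\<And>i. norm (\<mu> i) < 1"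
    and \<omega>: "induced_by \<mu> b \<phi> \<omega>" and z: "z \<in> W"
  shows "\<omega> z u = b * \<omega> (hopf_map \<mu> z) (hopf_map \<mu> u)"
proof -
  let ?w = "hopf_map \<mu> z"
  have \<mu>0: "\<mu> i \<noteq> 0" for i
    using \<mu>(1)[of i] by auto
  have w: "?w \<in> W"
    using z \<mu>0 by (simp add: hopf_map_in_W)
  have lin: "clinear_form (\<omega> z)" "clinear_form (\<lambda>u. b * \<omega> ?w u)"
    using \<omega> z w by (auto simp: induced_by_def holo_one_form_on_def intro: clinear_form_scale)
  have "cotangent_pt \<mu> z (\<lambda>u. 1 * \<omega> z u) = \<phi> (line_pt \<mu> b z 1)"
    using \<omega> z unfolding induced_by_def by metis
  also have "line_pt \<mu> b z 1 = line_pt \<mu> b ?w b"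
    by (rule line_pt_eqI[OF z w, where m = 1 and k = 0]) simp_all
  also have "\<phi> \<dots> = cotangent_pt \<mu> ?w (\<lambda>u. b * \<omega> ?w u)"
    using \<omega> w unfolding induced_by_def by blast
  also have "\<dots> = cotangent_pt \<mu> z (\<lambda>u. b * \<omega> ?w (hopf_map \<mu> u))"
    using cotangent_pt_transport[where \<mu> = \<mu>, OF \<mu>0 z w lin(2), where m = 1 and k = 0] by simp
  finally have "cotangent_pt \<mu> z (\<omega> z) = cotangent_pt \<mu> z (\<lambda>u. b * \<omega> ?w (hopf_map \<mu> u))"
    by simp
  then have "\<omega> z = (\<lambda>u. b * \<omega> ?w (hopf_map \<mu> u))"
    using \<omega> w by (intro cotangent_pt_inject[where \<mu> = \<mu>, OF \<mu> z lin(1)] clinear_form_scale_hopf_map)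
      (auto simp: induced_by_def holo_one_form_on_def)
  then show ?thesis
    by meson
qed

lemma clinear_form_expansion:
  assumes "clinear_form D"
  shows "D u = (\<Sum>k\<in>UNIV. D (axis k 1) * u $ k)"
proof -
  have "D 0 = 0"
    using assms unfolding clinear_form_iff by (metis add_cancel_right_right)
  then have sum: "D (sum h A) = (\<Sum>k\<in>A. D (h k))" for h :: "'a \<Rightarrow> complex ^ 'a" and A
    using assms by (induction A rule: infinite_finite_induct) (simp_all add: clinear_form_iff)
  have "D u = D (\<Sum>k\<in>UNIV. u $ k *s axis k 1)"
    by (simp add: basis_expansion)
  also have "\<dots> = (\<Sum>k\<in>UNIV. D (axis k 1) * u $ k)"
    using assms by (simp add: sum clinear_form_iff mult.commute)
  finally show ?thesis .
qed

section \<open>Monomial 1-forms\<close>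

definition monomial_one_form ::
    "('n::finite \<Rightarrow> complex) \<Rightarrow> ('n \<Rightarrow> 'n \<Rightarrow> nat) \<Rightarrow> 'n one_form" where
  "monomial_one_form c \<alpha> z u = (\<Sum>k\<in>UNIV. c k * mono_fun (\<alpha> k) z * u $ k)"

text \<open>
  The derivative in \<open>z\<close> of \<open>monomial_one_form c \<alpha> z v\<close>, in the direction \<open>u\<close>. The truncated difference
  \<open>\<alpha> k j - 1\<close> is harmless, as its term carries the factor \<open>\<alpha> k j\<close>.
\<close>

definition monomial_one_form_deriv ::
    "('n::finite \<Rightarrow> complex) \<Rightarrow> ('n \<Rightarrow> 'n \<Rightarrow> nat) \<Rightarrow>
      complex ^ 'n \<Rightarrow> complex ^ 'n \<Rightarrow> complex ^ 'n \<Rightarrow> complex" where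
  "monomial_one_form_deriv c \<alpha> z v u =
     (\<Sum>k\<in>UNIV. c k * (\<Sum>j\<in>UNIV. of_nat (\<alpha> k j) * mono_fun ((\<alpha> k)(j := \<alpha> k j - 1)) z * u $ j) * v $ k)"

lemma monomial_one_form_has_derivative:
  "((\<lambda>x. monomial_one_form c \<alpha> x v) has_derivative monomial_one_form_deriv c \<alpha> z v) (at z)"
  unfolding monomial_one_form_def monomial_one_form_deriv_def
  by (intro has_derivative_sum has_derivative_mult_left has_derivative_mult_right has_derivative_mono_fun)

lemma holo_monomial_one_form: "holo_one_form_on (monomial_one_form c \<alpha>) U"
proof -
  have "clinear_form (monomial_one_form_deriv c \<alpha> z v)" for z v
    by (simp add: clinear_form_iff monomial_one_form_deriv_def algebra_simps
        sum.distrib sum_distrib_left)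
  moreover have "clinear_form (monomial_one_form c \<alpha> z)" for z
    by (simp add: clinear_form_iff monomial_one_form_def algebra_simps sum.distrib sum_distrib_left)
  ultimately show ?thesis
    unfolding holo_one_form_on_def holo_fun_on_def
    using monomial_one_form_has_derivative by blast
qed

lemma mono_fun_lower:
  fixes z :: "complex ^ 'n::finite"
  assumes "z $ j \<noteq> 0"
  shows "of_nat (\<alpha> j) * mono_fun (\<alpha>(j := \<alpha> j - 1)) z = of_nat (\<alpha> j) * mono_fun \<alpha> z / z $ j"
proof (cases "\<alpha> j = 0")
  case False
  then have "mono_fun (\<alpha>(j := \<alpha> j - 1)) z * z $ j ^ 1 = mono_fun \<alpha> z"
    unfolding mono_fun_times_coord by (simp add: fun_upd_idem)
  then show ?thesis
    using assms by (simp add: field_simps)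
qed simp

text \<open>
  On the torus the form is \<open>z^m \<eta>\<close> with \<open>\<eta> = \<Sum> c\<^sub>k dz\<^sub>k / z\<^sub>k\<close> closed. With \<open>\<theta> = \<Sum> m\<^sub>j dz\<^sub>j / z\<^sub>j\<close>, its
  exterior derivative is \<open>z^m \<theta> \<and> \<eta>\<close>, whose wedge product with \<open>\<eta>\<close> is zero. In coordinates the
  derivative of \<open>\<eta>\<close> is, up to sign, the form \<open>\<sigma>\<close>, and closedness is the symmetry of \<open>\<sigma>\<close>. The integrability
  expression is continuous, so its vanishing extends to the coordinate hyperplanes.
\<close>

lemma integrable_monomial_one_form:
  fixes c :: "'n::finite \<Rightarrow> complex"
  assumes m: "\<And>k. c k \<noteq> 0 \<Longrightarrow> (\<alpha> k)(k := \<alpha> k k + 1) = m"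
  shows "integrable_form (monomial_one_form c \<alpha>)"
  unfolding integrable_form_def
proof (intro ballI allI)
  fix z u v w :: "complex ^ 'n"
  let ?\<omega> = "monomial_one_form c \<alpha>"
  let ?P = "monomial_one_form_deriv c \<alpha>"
  have ext: "ext_deriv ?\<omega> x = (\<lambda>u v. ?P x v u - ?P x u v)" for x
    unfolding ext_deriv_def
    by (simp add: frechet_derivative_at[OF monomial_one_form_has_derivative, symmetric])
  let ?E = "\<lambda>x. wedge12 (?\<omega> x) (ext_deriv ?\<omega> x) u v w"
  have "isCont ?E z"
    unfolding ext wedge12_def monomial_one_form_def monomial_one_form_deriv_def
    by (intro continuous_intros isCont_mono_fun)
  moreover have "?E x = 0" if x: "x \<in> torus" for x
  proof -
    have x0: "x $ j \<noteq> 0" for j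
      using x by (simp add: torus_def)
    define \<eta> where "\<eta> = (\<lambda>u. \<Sum>k\<in>UNIV. c k * u $ k / x $ k)"
    define \<theta> where "\<theta> = (\<lambda>u. \<Sum>j\<in>UNIV. of_nat (m j) * u $ j / x $ j)"
    define \<sigma> where "\<sigma> = (\<lambda>u v. \<Sum>k\<in>UNIV. c k * u $ k * v $ k / (x $ k)\<^sup>2)"
    have sym: "\<sigma> u v = \<sigma> v u" for u v
      unfolding \<sigma>_def by (simp add: mult_ac)
    have mono: "mono_fun (\<alpha> k) x = mono_fun m x / x $ k" if "c k \<noteq> 0" for k
      using mono_fun_times_coord[of "\<alpha> k" x k 1] m[OF that] x0[of k] by (simp add: field_simps)
    have \<omega>: "?\<omega> x u = mono_fun m x * \<eta> u" for u
    proof -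
      have "c k * mono_fun (\<alpha> k) x = mono_fun m x * (c k / x $ k)" for k
        by (cases "c k = 0") (simp_all add: mono)
      then show ?thesis
        unfolding monomial_one_form_def \<eta>_def sum_distrib_left by (simp add: mult_ac)
    qed
    have P: "?P x v u = mono_fun m x * (\<theta> u * \<eta> v - \<sigma> u v)" for u v
    proof -
      have "c k * (\<Sum>j\<in>UNIV. of_nat (\<alpha> k j) * mono_fun ((\<alpha> k)(j := \<alpha> k j - 1)) x * u $ j) * v $ k
          = mono_fun m x * (\<theta> u * (c k * v $ k / x $ k) - c k * u $ k * v $ k / (x $ k)\<^sup>2)" for k
      proof (cases "c k = 0")
        case False
        have mj: "of_nat (\<alpha> k j) = (of_nat (m j) - (if j = k then 1 else 0) :: complex)" for j
          unfolding m[OF False, symmetric] by simp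
        have "(\<Sum>j\<in>UNIV. of_nat (\<alpha> k j) * mono_fun ((\<alpha> k)(j := \<alpha> k j - 1)) x * u $ j)
            = (\<Sum>j\<in>UNIV. mono_fun (\<alpha> k) x *
                 (of_nat (m j) * u $ j / x $ j - (if j = k then u $ j / x $ j else 0)))"
          unfolding mono_fun_lower[OF x0] unfolding mj
          by (intro sum.cong refl) (auto simp: algebra_simps diff_divide_distrib)
        also have "\<dots> = mono_fun (\<alpha> k) x * (\<theta> u - u $ k / x $ k)"
          by (simp add: \<theta>_def sum_distrib_left[symmetric] sum_subtractf)
        finally have S: "(\<Sum>j\<in>UNIV. of_nat (\<alpha> k j) * mono_fun ((\<alpha> k)(j := \<alpha> k j - 1)) x * u $ j)
            = mono_fun (\<alpha> k) x * (\<theta> u - u $ k / x $ k)" .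
        show ?thesis
          unfolding S mono[OF False] using x0[of k] by (simp add: field_simps power2_eq_square)
      qed simp
      note summand = this
      show ?thesis
        unfolding monomial_one_form_deriv_def summand \<eta>_def \<sigma>_def
        by (simp only: sum_distrib_left[symmetric] sum_subtractf)
    qed
    show ?thesis
      unfolding ext wedge12_def \<omega> P using sym[of u v] sym[of v w] sym[of u w]
      by (simp add: algebra_simps)
  qed
  ultimately show "?E z = 0"
    by (rule zero_if_zero_on_torus)
qed

section \<open>Distributions on generic Hopf manifolds\<close>

theorem theorem1p10:
  fixes \<mu> :: "'n::{finite,linorder} \<Rightarrow> complex"
    and b :: complex
    and \<phi> :: "'n bundle_map"
  assumes "CARD('n) \<ge> 3"
    and "generic_hopf \<mu>"
    and "distribution \<mu> b \<phi>"
  shows "integrable_distribution \<mu> b \<phi> \<and> (\<exists>\<omega>. induced_by \<mu> b \<phi> \<omega> \<and> monomial_form \<omega>)"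
proof -
  have \<mu>: "0 < norm (\<mu> i)" "norm (\<mu> i) < 1" for i
    using assms(2) by (simp_all add: generic_hopf_def)
  have \<mu>0: "\<mu> i \<noteq> 0" for i
    using \<mu>(1)[of i] by auto
  have b: "b \<noteq> 0" and mor: "bundle_morphism \<mu> b \<phi>"
    using assms(3) by (auto simp: distribution_def)
  obtain \<omega> where \<omega>: "induced_by \<mu> b \<phi> \<omega>"
    using bundle_morphism_induced[OF \<mu> b mor] by blast
  then have holo: "holo_one_form_on \<omega> W"
    by (simp add: induced_by_def)
  have "\<exists>c \<alpha>. (\<forall>z\<in>W. \<omega> z (axis k 1) = c * mono_fun \<alpha> z) \<and>
      (c \<noteq> 0 \<longrightarrow> (\<Prod>i\<in>UNIV. \<mu> i ^ \<alpha> i) = inverse (b * \<mu> k))" for k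
  proof (rule hopf_eigenfunction_is_monomial[OF _ \<mu> generic_hopf_independent[OF assms(2)]])
    show "\<omega> (hopf_map \<mu> z) (axis k 1) = inverse (b * \<mu> k) * \<omega> z (axis k 1)" if z: "z \<in> W" for z
    proof -
      have "clinear_form (\<omega> (hopf_map \<mu> z))"
        using holo z \<mu>0 by (simp add: holo_one_form_on_def hopf_map_in_W)
      moreover have "hopf_map \<mu> (axis k 1) = \<mu> k *s axis k 1"
        by (simp add: vec_eq_iff hopf_map_nth axis_def)
      ultimately have "\<omega> z (axis k 1) = b * \<mu> k * \<omega> (hopf_map \<mu> z) (axis k 1)"
        using induced_by_equivariant[OF \<mu> \<omega> z, of "axis k 1"] by (simp add: clinear_form_iff)
      then show ?thesis
        using b \<mu>0[of k] by (simp add: field_simps)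
    qed
  qed (use assms(1) b \<mu>0 holo in \<open>auto simp: holo_one_form_on_def\<close>)
  then obtain c \<alpha> where c: "\<And>k z. z \<in> W \<Longrightarrow> \<omega> z (axis k 1) = c k * mono_fun (\<alpha> k) z"
    and weight: "\<And>k. c k \<noteq> 0 \<Longrightarrow> (\<Prod>i\<in>UNIV. \<mu> i ^ \<alpha> k i) = inverse (b * \<mu> k)"
    by metis
  let ?\<omega> = "monomial_one_form c \<alpha>"
  have "\<omega> z u = ?\<omega> z u" if z: "z \<in> W" for z u
  proof -
    have "\<omega> z u = (\<Sum>k\<in>UNIV. \<omega> z (axis k 1) * u $ k)"
      using holo z by (intro clinear_form_expansion) (simp add: holo_one_form_on_def)
    then show ?thesis
      by (simp add: c[OF z] monomial_one_form_def)
  qed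
  then have ind: "induced_by \<mu> b \<phi> ?\<omega>"
    using \<omega> by (simp add: induced_by_def holo_monomial_one_form)
  have mono: "monomial_form ?\<omega>"
    unfolding monomial_form_def monomial_one_form_def mono_fun_def by blast
  \<comment> \<open>The weight of the monomial 1-form \<open>z^\<alpha> dz\<^sub>k\<close> does not depend on \<open>k\<close>, because \<open>dz\<^sub>k\<close>
    contributes the missing factor \<open>\<mu> k\<close>.\<close>
  have total: "(\<Prod>i\<in>UNIV. \<mu> i ^ ((\<alpha> k)(k := \<alpha> k k + 1)) i) = inverse b" if "c k \<noteq> 0" for k
  proof -
    let ?v = "\<chi> i. \<mu> i"
    have "mono_fun ((\<alpha> k)(k := \<alpha> k k + 1)) ?v = mono_fun (\<alpha> k) ?v * \<mu> k"
      using mono_fun_times_coord[of "\<alpha> k" ?v k 1] by simp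
    then show ?thesis
      using weight[OF that] \<mu>0 by (simp add: mono_fun_def)
  qed
  have "\<exists>m. \<forall>k. c k \<noteq> 0 \<longrightarrow> (\<alpha> k)(k := \<alpha> k k + 1) = m"
    using generic_hopf_independent[OF assms(2)] total by metis
  then have "integrable_form ?\<omega>"
    using integrable_monomial_one_form by blast
  then show ?thesis
    using ind mono unfolding integrable_distribution_def by blast
qed

end
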